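(* Let $\Phi=(\phi_n)$ be a frame for $\mathcal H$ with upper bound $B_\Phi$, let $\Psi=(\psi_n)$ be a sequence in $\mathcal H$ and $m=(m_n)$ a complex scalar sequence, with $m_n\neq0$, $\phi_n\neq0$, $\psi_n\ne0$ for all $n$. Assume that for some dual frame $\Phi^d=(\phi_n^d)$ of $\Phi$ there exists $\mu\in[0,\frac1{B_\Phi})$ such that $$\sum|\langle f,m_n\psi_n-\phi_n^d\rangle|^2\le\mu\|f\|^2,\quad\forall f\in\mathcal H.$$ Then $m\Psi=(m_n\psi_n)$ is a frame for $\mathcal H$, the multipliers $M_{\overline m,\Phi,\Psi}$ and $M_{m,\Psi,\Phi}$ are invertible on $\mathcal H$ and $$\frac{1}{1+\sqrt{\mu B_\Phi}}\|h\|\le\|M^{-1}h\|\le\frac{1}{1-\sqrt{\mu B_\Phi}}\|h\|,\quad\forall h\in\mathcal H,$$ $$M^{-1}=\sum_{k=0}^\infty(I_{\mathcal H}-M)^k,$$ where $M$ denotes any one of $M_{\overline m,\Phi,\Psi}$ and $M_{m,\Psi,\Phi}$. As a consequence, if $m$ is semi-normalized, then $\Psi$ is also a frame for $\mathcal H$.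
   Context: $\mathcal H$ is a separable infinite-dimensional complex Hilbert space with identity operator $I_{\mathcal H}$, inner product linear in the first argument; all sequences are indexed by $\mathbb N$. The multiplier is $M_{m,\Phi,\Psi}f=\sum_n m_n\langle f,\psi_n\rangle\phi_n$; it is invertible on $\mathcal H$ if the series converges for every $f\in\mathcal H$ and the resulting operator has a bounded two-sided inverse $\mathcal H\to\mathcal H$. $\overline m=(\overline{m_n})$. A frame for $\mathcal H$ with bounds $A_\Phi,B_\Phi$ is a sequence $\Phi$ with $A_\Phi>0$ and $A_\Phi\|h\|^2\le\sum|\langle h,\phi_n\rangle|^2\le B_\Phi\|h\|^2$ for all $h\in\mathcal H$; $B_\Phi$ is an upper bound. A dual frame of $\Phi$ is a frame $(\phi_n^d)$ for $\mathcal H$ with $h=\sum\langle h,\phi_n^d\rangle\phi_n=\sum\langle h,\phi_n\rangle\phi_n^d$ for all $h\in\mathcal H$. $m$ is semi-normalized if $0<a\le|m_n|\le b<\infty$ for all $n$ for some constants $a,b$. Infinite series of operators are understood as converging in operator norm. *)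

theory Defs
  imports "HOL-Analysis.Analysis"
begin

text \<open>
  A complex inner product space carries the real inner product \<open>Re \<langle>x, y\<rangle>\<close>, which
  induces the same norm.  Extending \<^class>\<open>real_inner\<close> in this way makes the norm equal to
  \<open>sqrt \<langle>x, x\<rangle>\<close> and gives definiteness of the complex inner product.  The inner product
  \<open>cinner\<close> is linear in its first argument.
\<close>

class complex_inner = real_inner +
  fixes scaleC :: "complex \<Rightarrow> 'a \<Rightarrow> 'a" (infixr \<open>*\<^sub>C\<close> 75)
    and cinner :: "'a \<Rightarrow> 'a \<Rightarrow> complex"
  assumes scaleC_add_right: "a *\<^sub>C (x + y) = a *\<^sub>C x + a *\<^sub>C y"
    and scaleC_add_left: "(a + b) *\<^sub>C x = a *\<^sub>C x + b *\<^sub>C x"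
    and scaleC_scaleC: "a *\<^sub>C (b *\<^sub>C x) = (a * b) *\<^sub>C x"
    and scaleR_scaleC: "r *\<^sub>R x = complex_of_real r *\<^sub>C x"
    and cinner_commute: "cinner x y = cnj (cinner y x)"
    and cinner_add_left: "cinner (x + y) z = cinner x z + cinner y z"
    and cinner_scaleC_left: "cinner (a *\<^sub>C x) y = a * cinner x y"
    and inner_eq_Re_cinner: "inner x y = Re (cinner x y)"

class complex_hilbert = complex_inner + banach

global_interpretation complex_vector:
  vector_space "scaleC :: complex \<Rightarrow> 'a \<Rightarrow> 'a::complex_inner"
proof
  fix x :: 'a
  show "1 *\<^sub>C x = x"
    using scaleR_scaleC[of 1 x] by simp
qed (simp_all add: scaleC_add_right scaleC_add_left scaleC_scaleC)

lemma cinner_self: "cinner x x = complex_of_real ((norm x)\<^sup>2)" for x :: "'a::complex_inner"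
proof -
  have "Im (cinner x x) = - Im (cinner x x)"
    using arg_cong[OF cinner_commute[of x x], of Im] by simp
  then show ?thesis
    by (simp add: complex_eq_iff power2_norm_eq_inner inner_eq_Re_cinner)
qed

definition infinite_dimensional :: "'a::complex_inner itself \<Rightarrow> bool" where
  "infinite_dimensional _ \<longleftrightarrow>
     \<not> (\<exists>S :: 'a set. finite S \<and> complex_vector.span S = UNIV)"

definition has_frame_bounds :: "(nat \<Rightarrow> 'a::complex_hilbert) \<Rightarrow> real \<Rightarrow> real \<Rightarrow> bool" where
  "has_frame_bounds \<Phi> A B \<longleftrightarrow>
     A > 0 \<and>
     (\<forall>h. summable (\<lambda>n. (cmod (cinner h (\<Phi> n)))\<^sup>2) \<and>
          A * (norm h)\<^sup>2 \<le> (\<Sum>n. (cmod (cinner h (\<Phi> n)))\<^sup>2) \<and>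
          (\<Sum>n. (cmod (cinner h (\<Phi> n)))\<^sup>2) \<le> B * (norm h)\<^sup>2)"

definition is_frame :: "(nat \<Rightarrow> 'a::complex_hilbert) \<Rightarrow> bool" where
  "is_frame \<Phi> \<longleftrightarrow> (\<exists>A B. has_frame_bounds \<Phi> A B)"

definition is_dual_frame :: "(nat \<Rightarrow> 'a::complex_hilbert) \<Rightarrow> (nat \<Rightarrow> 'a) \<Rightarrow> bool" where
  "is_dual_frame \<Phi> \<Phi>d \<longleftrightarrow>
     is_frame \<Phi>d \<and>
     (\<forall>h. (\<lambda>n. cinner h (\<Phi>d n) *\<^sub>C \<Phi> n) sums h \<and>
          (\<lambda>n. cinner h (\<Phi> n) *\<^sub>C \<Phi>d n) sums h)"

definition semi_normalized :: "(nat \<Rightarrow> complex) \<Rightarrow> bool" where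
  "semi_normalized m \<longleftrightarrow> (\<exists>a b. 0 < a \<and> (\<forall>n. a \<le> cmod (m n) \<and> cmod (m n) \<le> b))"

definition bounded_clinear :: "('a::complex_hilbert \<Rightarrow> 'a) \<Rightarrow> bool" where
  "bounded_clinear T \<longleftrightarrow> bounded_linear T \<and> (\<forall>c x. T (c *\<^sub>C x) = c *\<^sub>C T x)"

text \<open>
  The value of \<open>multiplier m \<Phi> \<Psi>\<close> at \<open>f\<close> is meaningful only if the series converges;
  \<open>multiplier_invertible\<close> includes this convergence for every \<open>f\<close>.
\<close>

definition multiplier ::
  "(nat \<Rightarrow> complex) \<Rightarrow> (nat \<Rightarrow> 'a::complex_hilbert) \<Rightarrow> (nat \<Rightarrow> 'a) \<Rightarrow> 'a \<Rightarrow> 'a" where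
  "multiplier m \<Phi> \<Psi> f = (\<Sum>n. (m n * cinner f (\<Psi> n)) *\<^sub>C \<Phi> n)"

definition multiplier_invertible ::
  "(nat \<Rightarrow> complex) \<Rightarrow> (nat \<Rightarrow> 'a::complex_hilbert) \<Rightarrow> (nat \<Rightarrow> 'a) \<Rightarrow> bool" where
  "multiplier_invertible m \<Phi> \<Psi> \<longleftrightarrow>
     (\<forall>f. summable (\<lambda>n. (m n * cinner f (\<Psi> n)) *\<^sub>C \<Phi> n)) \<and>
     (\<exists>N. bounded_clinear N \<and>
          (\<forall>h. N (multiplier m \<Phi> \<Psi> h) = h) \<and>
          (\<forall>h. multiplier m \<Phi> \<Psi> (N h) = h))"

text \<open>
  Convergence of a series of bounded operators in operator norm.  Boundedness is required
  explicitly because \<^const>\<open>onorm\<close> is unspecified on unbounded maps.  The operator norm of a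
  complex linear map does not depend on whether the scalars are real or complex.
\<close>

definition op_sums :: "(nat \<Rightarrow> 'a::complex_hilbert \<Rightarrow> 'a) \<Rightarrow> ('a \<Rightarrow> 'a) \<Rightarrow> bool" where
  "op_sums T S \<longleftrightarrow>
     (\<forall>k. bounded_clinear (T k)) \<and> bounded_clinear S \<and>
     (\<lambda>N. onorm (\<lambda>h. S h - (\<Sum>k<N. T k h))) \<longlonglongrightarrow> 0"

end

theory Submission
  imports Defs
begin

text \<open>
  Write \<open>m\<^sub>n \<psi>\<^sub>n = \<phi>\<^sup>d\<^sub>n + e\<^sub>n\<close>, where \<open>(e\<^sub>n)\<close> is Bessel with bound \<open>\<mu>\<close>.  By the reconstruction formulas
  for the dual frame, the two multipliers are \<open>f \<mapsto> f + \<Sum>n. \<langle>f, e\<^sub>n\<rangle> \<phi>\<^sub>n\<close> and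
  \<open>f \<mapsto> f + \<Sum>n. \<langle>f, \<phi>\<^sub>n\<rangle> e\<^sub>n\<close>.  In both cases the perturbation of the identity has norm at most
  \<open>sqrt (\<mu> B) < 1\<close>, so the Neumann series gives the inverse and its bounds.  The lower frame bound of
  \<open>m\<Psi>\<close> follows because \<open>M f\<close> is synthesized from the coefficients \<open>\<langle>f, m\<^sub>n \<psi>\<^sub>n\<rangle>\<close> by a Bessel sequence
  while \<open>norm (M f)\<close> is at least \<open>(1 - sqrt (\<mu> B)) norm f\<close>.
\<close>

section \<open>Complex inner product, norm and complex linearity\<close>

lemma cinner_scaleC_right: "cinner x (a *\<^sub>C y) = cnj a * cinner x y" for x :: "'a::complex_inner"
proof -
  have "cinner x (a *\<^sub>C y) = cnj (a * cinner y x)"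
    by (subst cinner_commute) (simp add: cinner_scaleC_left)
  also have "\<dots> = cnj a * cnj (cinner y x)" by simp
  also have "cnj (cinner y x) = cinner x y" by (metis cinner_commute)
  finally show ?thesis .
qed

lemma cinner_add_right: "cinner x (y + z) = cinner x y + cinner x z" for x :: "'a::complex_inner"
proof -
  have "cinner x (y + z) = cnj (cinner y x + cinner z x)"
    by (subst cinner_commute) (simp add: cinner_add_left)
  also have "\<dots> = cnj (cinner y x) + cnj (cinner z x)" by simp
  finally show ?thesis by (metis cinner_commute)
qed

lemma cmod_cinner_commute: "cmod (cinner x y) = cmod (cinner y x)" for x :: "'a::complex_inner"
  by (subst cinner_commute) simp

lemma cinner_sum_left: "cinner (\<Sum>i\<in>F. g i) y = (\<Sum>i\<in>F. cinner (g i) y)"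
  for y :: "'a::complex_inner"
proof -
  have "cinner 0 y = 0" using cinner_add_left[of 0 0 y] by simp
  then show ?thesis by (induction F rule: infinite_finite_induct) (simp_all add: cinner_add_left)
qed

text \<open>The class ties the norm to real scaling only. Complex homogeneity comes from the
  sesquilinearity of \<open>cinner\<close>, by comparing squares.\<close>

lemma norm_scaleC: "norm (c *\<^sub>C x) = cmod c * norm x" for x :: "'a::complex_inner"
proof -
  have "complex_of_real ((norm (c *\<^sub>C x))\<^sup>2) = c * cnj c * complex_of_real ((norm x)\<^sup>2)"
    by (simp only: cinner_self[symmetric] cinner_scaleC_left cinner_scaleC_right mult_ac)
  also have "\<dots> = complex_of_real ((cmod c * norm x)\<^sup>2)"
    by (simp only: complex_norm_square[symmetric] of_real_mult power_mult_distrib)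
  finally have "(norm (c *\<^sub>C x))\<^sup>2 = (cmod c * norm x)\<^sup>2"
    by (simp only: of_real_eq_iff)
  then show ?thesis by (simp add: power2_eq_iff_nonneg)
qed

lemma bounded_linear_scaleC_right: "bounded_linear (\<lambda>x :: 'a::complex_inner. c *\<^sub>C x)"
proof (rule bounded_linear_intro[where K = "cmod c"])
  fix r :: real and x :: 'a
  show "c *\<^sub>C (r *\<^sub>R x) = r *\<^sub>R (c *\<^sub>C x)"
    by (simp add: scaleR_scaleC scaleC_scaleC mult.commute)
qed (simp_all add: scaleC_add_right norm_scaleC mult.commute)

lemma bounded_clinear_intro:
  fixes T :: "'a::complex_hilbert \<Rightarrow> 'a"
  assumes "\<And>x y. T (x + y) = T x + T y" and scale: "\<And>c x. T (c *\<^sub>C x) = c *\<^sub>C T x"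
    and "\<And>x. norm (T x) \<le> K * norm x"
  shows "bounded_clinear T"
  unfolding bounded_clinear_def
proof (intro conjI allI scale)
  show "bounded_linear T"
    by (rule bounded_linear_intro[where K = K])
      (use assms in \<open>simp_all add: scaleR_scaleC mult.commute\<close>)
qed

section \<open>Bessel sequences and synthesis\<close>

lemma L2_set_le_sqrt_suminf:
  assumes "summable (\<lambda>n. (f n)\<^sup>2)" "finite F"
  shows "L2_set f F \<le> sqrt (\<Sum>n. (f n)\<^sup>2)"
  unfolding L2_set_def by (intro real_sqrt_le_mono sum_le_suminf assms) auto

text \<open>The upper half of the frame condition. Nonnegativity of \<open>C\<close> is explicit so
  that \<open>sqrt C\<close> can serve as a nonnegative factor in estimates.\<close>

definition bessel :: "(nat \<Rightarrow> 'a::complex_hilbert) \<Rightarrow> real \<Rightarrow> bool" where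
  "bessel X C \<longleftrightarrow> 0 \<le> C \<and> (\<forall>f. summable (\<lambda>n. (cmod (cinner f (X n)))\<^sup>2) \<and>
     (\<Sum>n. (cmod (cinner f (X n)))\<^sup>2) \<le> C * (norm f)\<^sup>2)"

lemma bessel_sqrt_le:
  assumes "bessel X C"
  shows "sqrt (\<Sum>n. (cmod (cinner f (X n)))\<^sup>2) \<le> sqrt C * norm f"
proof -
  have "sqrt (\<Sum>n. (cmod (cinner f (X n)))\<^sup>2) \<le> sqrt (C * (norm f)\<^sup>2)"
    using assms by (auto simp: bessel_def)
  then show ?thesis by (simp add: real_sqrt_mult)
qed

text \<open>Pair the finite sum \<open>?x\<close> with itself, apply Cauchy-Schwarz, bound the
  coefficients of \<open>?x\<close> by the Bessel inequality, and cancel one factor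
  \<open>norm ?x\<close>.\<close>

lemma bessel_sum_norm_le:
  assumes X: "bessel X C" and F: "finite F"
  shows "norm (\<Sum>n\<in>F. c n *\<^sub>C X n) \<le> sqrt C * L2_set (\<lambda>n. cmod (c n)) F"
proof -
  let ?x = "\<Sum>n\<in>F. c n *\<^sub>C X n"
  have "(norm ?x)\<^sup>2 = cmod (cinner ?x ?x)"
    by (simp only: cinner_self norm_of_real abs_power2)
  also have "\<dots> = cmod (\<Sum>n\<in>F. c n * cinner (X n) ?x)"
    by (subst cinner_sum_left) (simp add: cinner_scaleC_left)
  also have "\<dots> \<le> (\<Sum>n\<in>F. \<bar>cmod (c n)\<bar> * \<bar>cmod (cinner ?x (X n))\<bar>)"
    by (rule sum_norm_le) (simp add: norm_mult cmod_cinner_commute)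
  also have "\<dots> \<le> L2_set (\<lambda>n. cmod (c n)) F * L2_set (\<lambda>n. cmod (cinner ?x (X n))) F"
    by (rule L2_set_mult_ineq)
  also have "\<dots> \<le> L2_set (\<lambda>n. cmod (c n)) F * (sqrt C * norm ?x)"
  proof (rule mult_left_mono)
    have "L2_set (\<lambda>n. cmod (cinner ?x (X n))) F \<le> sqrt (\<Sum>n. (cmod (cinner ?x (X n)))\<^sup>2)"
      using X F by (intro L2_set_le_sqrt_suminf) (auto simp: bessel_def)
    also have "\<dots> \<le> sqrt C * norm ?x" by (rule bessel_sqrt_le[OF X])
    finally show "L2_set (\<lambda>n. cmod (cinner ?x (X n))) F \<le> sqrt C * norm ?x" .
  qed (rule L2_set_nonneg)
  finally have *: "norm ?x * norm ?x \<le> (sqrt C * L2_set (\<lambda>n. cmod (c n)) F) * norm ?x"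
    by (simp add: power2_eq_square mult_ac)
  show ?thesis
  proof (cases "norm ?x = 0")
    case True
    then show ?thesis using X by (simp add: bessel_def)
  next
    case False
    then show ?thesis using * mult_right_le_imp_le[of "norm ?x" "norm ?x"] by simp
  qed
qed

text \<open>The finite estimate on blocks \<open>{m..<n}\<close> makes the partial sums Cauchy, so
  completeness gives convergence; on initial segments it gives the norm bound in the limit.\<close>

lemma bessel_synthesis:
  assumes X: "bessel X C" and c: "summable (\<lambda>n. (cmod (c n))\<^sup>2)"
  shows "summable (\<lambda>n. c n *\<^sub>C X n)"
    and "norm (\<Sum>n. c n *\<^sub>C X n) \<le> sqrt C * sqrt (\<Sum>n. (cmod (c n))\<^sup>2)"
proof -
  have C: "0 \<le> C" using X by (simp add: bessel_def)
  show summ: "summable (\<lambda>n. c n *\<^sub>C X n)"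
    unfolding summable_Cauchy
  proof (intro allI impI)
    fix e :: real assume e: "e > 0"
    \<comment> \<open>The summand 1 avoids division by zero when \<open>C = 0\<close> and makes
      \<open>sqrt C * d < e\<close> strict.\<close>
    define d where "d = e / (sqrt C + 1)"
    have "0 \<le> sqrt C" using C by simp
    then have pos: "sqrt C + 1 > 0" by linarith
    have d: "d > 0" using e pos by (simp add: d_def)
    have "(sqrt C + 1) * d = e" using pos by (simp add: d_def)
    then have dC: "sqrt C * d < e" using d by (simp add: distrib_right)
    obtain N where N: "\<And>m n. N \<le> m \<Longrightarrow> norm (\<Sum>k=m..<n. (cmod (c k))\<^sup>2) < d\<^sup>2"
      using c d unfolding summable_Cauchy by (metis zero_less_power)
    have "norm (\<Sum>k=m..<n. c k *\<^sub>C X k) < e" if "N \<le> m" for m n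
    proof -
      have "L2_set (\<lambda>n. cmod (c n)) {m..<n} \<le> sqrt (d\<^sup>2)"
        unfolding L2_set_def using N[OF that, of n] by (intro real_sqrt_le_mono) auto
      then have "L2_set (\<lambda>n. cmod (c n)) {m..<n} \<le> d" using d by simp
      then have "sqrt C * L2_set (\<lambda>n. cmod (c n)) {m..<n} \<le> sqrt C * d"
        using C by (intro mult_left_mono) auto
      then show ?thesis using bessel_sum_norm_le[OF X, of "{m..<n}" c] dC by simp
    qed
    then show "\<exists>N. \<forall>m\<ge>N. \<forall>n. norm (\<Sum>k=m..<n. c k *\<^sub>C X k) < e" by blast
  qed
  show "norm (\<Sum>n. c n *\<^sub>C X n) \<le> sqrt C * sqrt (\<Sum>n. (cmod (c n))\<^sup>2)"
  proof (rule LIMSEQ_le_const2)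
    show "(\<lambda>N. norm (\<Sum>n<N. c n *\<^sub>C X n)) \<longlonglongrightarrow> norm (\<Sum>n. c n *\<^sub>C X n)"
      by (intro tendsto_norm summable_LIMSEQ summ)
    show "\<exists>N. \<forall>n\<ge>N. norm (\<Sum>n<n. c n *\<^sub>C X n) \<le> sqrt C * sqrt (\<Sum>n. (cmod (c n))\<^sup>2)"
    proof (intro exI allI impI)
      fix n
      have "sqrt C * L2_set (\<lambda>n. cmod (c n)) {..<n} \<le> sqrt C * sqrt (\<Sum>n. (cmod (c n))\<^sup>2)"
        using C by (intro mult_left_mono L2_set_le_sqrt_suminf c) auto
      then show "norm (\<Sum>n<n. c n *\<^sub>C X n) \<le> sqrt C * sqrt (\<Sum>n. (cmod (c n))\<^sup>2)"
        using bessel_sum_norm_le[OF X, of "{..<n}" c] by simp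
    qed
  qed
qed

text \<open>Analysis by \<open>X\<close> costs a factor \<open>sqrt C\<close>, synthesis by
  \<open>Y\<close> a factor \<open>sqrt D\<close>. Both error operators have this form, with the two
  sequences exchanged.\<close>

lemma bessel_mixed_operator:
  fixes X Y :: "nat \<Rightarrow> 'a::complex_hilbert"
  assumes X: "bessel X C" and Y: "bessel Y D"
  defines "T \<equiv> \<lambda>f. \<Sum>n. cinner f (X n) *\<^sub>C Y n"
  shows "summable (\<lambda>n. cinner f (X n) *\<^sub>C Y n)"
    and "norm (T f) \<le> sqrt (C * D) * norm f"
    and "bounded_clinear T"
proof -
  have summ: "summable (\<lambda>n. cinner f (X n) *\<^sub>C Y n)" for f
    using X by (intro bessel_synthesis(1)[OF Y]) (simp add: bessel_def)
  then show "summable (\<lambda>n. cinner f (X n) *\<^sub>C Y n)" .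
  have bound: "norm (T f) \<le> sqrt (C * D) * norm f" for f
  proof -
    have "norm (T f) \<le> sqrt D * sqrt (\<Sum>n. (cmod (cinner f (X n)))\<^sup>2)"
      unfolding T_def using X by (intro bessel_synthesis(2)[OF Y]) (simp add: bessel_def)
    also have "\<dots> \<le> sqrt D * (sqrt C * norm f)"
      using Y by (intro mult_left_mono bessel_sqrt_le[OF X]) (simp add: bessel_def)
    finally show ?thesis by (simp add: real_sqrt_mult mult_ac)
  qed
  then show "norm (T f) \<le> sqrt (C * D) * norm f" .
  show "bounded_clinear T"
  proof (rule bounded_clinear_intro[OF _ _ bound])
    show "T (x + y) = T x + T y" for x y
      unfolding T_def by (simp add: cinner_add_left scaleC_add_left suminf_add summ)
    show "T (c *\<^sub>C x) = c *\<^sub>C T x" for c x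
      unfolding T_def
      by (simp add: cinner_scaleC_left bounded_linear.suminf[OF bounded_linear_scaleC_right summ]
          scaleC_scaleC)
  qed
qed

text \<open>In the zero space an upper frame bound may be negative, hence the absolute
  value.\<close>

lemma frame_imp_bessel:
  assumes "has_frame_bounds X A B"
  shows "bessel X \<bar>B\<bar>"
proof -
  have "B * (norm f)\<^sup>2 \<le> \<bar>B\<bar> * (norm f)\<^sup>2" for f :: 'a
    by (rule mult_right_mono) auto
  then show ?thesis using assms unfolding has_frame_bounds_def bessel_def
    by (meson abs_ge_zero order_trans)
qed

text \<open>The constant comes from \<open>(p + q)^2 \<le> 2 * p^2 + 2 * q^2\<close>. It is not
  sharp, but \<open>is_frame\<close> only asks for some upper bound.\<close>

lemma bessel_add:
  assumes X: "bessel X C" and Y: "bessel Y D"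
  shows "bessel (\<lambda>n. X n + Y n) (2 * C + 2 * D)"
  unfolding bessel_def
proof (intro conjI allI)
  show "0 \<le> 2 * C + 2 * D" using X Y by (simp add: bessel_def)
  fix f :: 'a
  let ?x = "\<lambda>n. (cmod (cinner f (X n)))\<^sup>2" and ?y = "\<lambda>n. (cmod (cinner f (Y n)))\<^sup>2"
    and ?z = "\<lambda>n. (cmod (cinner f (X n + Y n)))\<^sup>2"
  have sx: "summable ?x" "suminf ?x \<le> C * (norm f)\<^sup>2"
    and sy: "summable ?y" "suminf ?y \<le> D * (norm f)\<^sup>2"
    using X Y by (auto simp: bessel_def)
  have le: "?z n \<le> 2 * ?x n + 2 * ?y n" for n
  proof -
    let ?p = "cmod (cinner f (X n))" and ?q = "cmod (cinner f (Y n))"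
    have "cmod (cinner f (X n + Y n)) \<le> ?p + ?q"
      by (simp add: cinner_add_right norm_triangle_ineq)
    then have "?z n \<le> (?p + ?q)\<^sup>2" by (rule power_mono) simp
    also have "\<dots> \<le> 2 * ?p\<^sup>2 + 2 * ?q\<^sup>2"
      using sum_squares_bound[of ?p ?q] by (simp add: power2_sum)
    finally show ?thesis .
  qed
  have s: "summable (\<lambda>n. 2 * ?x n + 2 * ?y n)" by (intro summable_add summable_mult sx sy)
  show sz: "summable ?z" by (rule summable_comparison_test'[OF s, of 0]) (use le in auto)
  have "suminf ?z \<le> (\<Sum>n. 2 * ?x n + 2 * ?y n)" by (rule suminf_le[OF le sz s])
  also have "\<dots> = 2 * suminf ?x + 2 * suminf ?y"
    by (simp add: suminf_add[symmetric] suminf_mult sx sy summable_mult)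
  finally show "suminf ?z \<le> (2 * C + 2 * D) * (norm f)\<^sup>2"
    using sx(2) sy(2) by (simp add: algebra_simps)
qed

section \<open>Neumann series and multipliers near the identity\<close>

lemma bounded_clinear_funpow:
  assumes K: "bounded_clinear K" and le: "\<And>h. norm (K h) \<le> q * norm h" and q: "0 \<le> q"
  shows "bounded_clinear (K ^^ k)" and "norm ((K ^^ k) h) \<le> q ^ k * norm h"
proof -
  have bound: "norm ((K ^^ k) h) \<le> q ^ k * norm h" for k h
  proof (induction k)
    case (Suc k)
    have "norm ((K ^^ Suc k) h) \<le> q * norm ((K ^^ k) h)" using le by simp
    also have "\<dots> \<le> q * (q ^ k * norm h)" by (rule mult_left_mono[OF Suc q])
    finally show ?case by simp
  qed simp
  show "norm ((K ^^ k) h) \<le> q ^ k * norm h" by (rule bound)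
  have "bounded_linear K" using K by (simp add: bounded_clinear_def)
  then interpret K: bounded_linear K .
  have add: "(K ^^ k) (x + y) = (K ^^ k) x + (K ^^ k) y" for x y
    by (induction k) (simp_all add: K.add)
  have "(K ^^ k) (c *\<^sub>C x) = c *\<^sub>C (K ^^ k) x" for c x
    by (induction k) (use K in \<open>simp_all add: bounded_clinear_def\<close>)
  then show "bounded_clinear (K ^^ k)" by (rule bounded_clinear_intro[OF add _ bound])
qed

text \<open>The sum \<open>S\<close> of the powers of \<open>K = I - M\<close> is a two-sided
  inverse of \<open>M\<close>, so \<open>inv M\<close> is \<open>S\<close>. The upper bound is the
  geometric series; the lower one is the triangle inequality for
  \<open>h = S h - K (S h)\<close>.\<close>

lemma neumann_series:
  fixes M :: "'a::complex_hilbert \<Rightarrow> 'a"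
  assumes K: "bounded_clinear (\<lambda>h. h - M h)"
    and le: "\<And>h. norm (h - M h) \<le> q * norm h" and q: "0 \<le> q" "q < 1"
  shows "bounded_clinear (inv M)" and "bij M"
    and "op_sums (\<lambda>k. (\<lambda>h. h - M h) ^^ k) (inv M)"
    and "1 / (1 + q) * norm h \<le> norm (inv M h)"
    and "norm (inv M h) \<le> 1 / (1 - q) * norm h"
proof -
  define K where "K = (\<lambda>h. h - M h)"
  define S where "S h = (\<Sum>k. (K ^^ k) h)" for h
  have K: "bounded_clinear K" and le: "norm (K h) \<le> q * norm h" for h
    using K le by (simp_all add: K_def)
  note pow = bounded_clinear_funpow[OF K le q(1)]
  have "bounded_linear K" using K by (simp add: bounded_clinear_def)
  then interpret K: bounded_linear K .
  have geo: "summable (\<lambda>k. q ^ k * norm h)" for h :: 'a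
    by (intro summable_mult2 summable_geometric) (use q in simp)
  have summ: "summable (\<lambda>k. (K ^^ k) h)" for h
    by (rule summable_comparison_test'[OF geo, of 0]) (rule pow(2))
  \<comment> \<open>Used twice: \<open>N = 0\<close> bounds \<open>S\<close> itself, and general
    \<open>N\<close> gives convergence in operator norm, the factor being independent of
    \<open>h\<close>.\<close>
  have tail: "norm (S h - (\<Sum>k<N. (K ^^ k) h)) \<le> q ^ N / (1 - q) * norm h" for h N
  proof -
    have "S h - (\<Sum>k<N. (K ^^ k) h) = (\<Sum>k. (K ^^ (k + N)) h)"
      unfolding S_def by (subst suminf_minus_initial_segment[OF summ]) simp
    also have "norm \<dots> \<le> (\<Sum>k. q ^ N * (q ^ k * norm h))"
    proof (rule norm_suminf_le)
      show "norm ((K ^^ (k + N)) h) \<le> q ^ N * (q ^ k * norm h)" for k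
        using pow(2)[of "k + N" h] by (simp add: power_add mult_ac)
    qed (intro summable_mult geo)
    also have "\<dots> = q ^ N / (1 - q) * norm h"
      using q by (simp add: suminf_mult geo suminf_mult2[symmetric] summable_geometric
          suminf_geometric)
    finally show ?thesis .
  qed
  have powl: "bounded_linear (K ^^ k)" "(K ^^ k) (c *\<^sub>C x) = c *\<^sub>C (K ^^ k) x" for k c x
    using pow(1)[of k] by (simp_all add: bounded_clinear_def)
  have S_add: "S (x + y) = S x + S y" for x y
    unfolding S_def by (simp add: linear_add[OF bounded_linear.linear[OF powl(1)]] suminf_add summ)
  have S_scale: "S (c *\<^sub>C x) = c *\<^sub>C S x" for c x
    unfolding S_def
    by (simp add: powl(2) bounded_linear.suminf[OF bounded_linear_scaleC_right summ])
  have S_bound: "norm (S h) \<le> 1 / (1 - q) * norm h" for h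
    using tail[of h 0] by simp
  have S: "bounded_clinear S"
    by (rule bounded_clinear_intro[OF S_add S_scale S_bound])
  \<comment> \<open>Removing the term \<open>k = 0\<close>, which is \<open>h\<close>, amounts to
    applying \<open>K\<close> either outside or inside the series; both inverse identities follow
    from this.\<close>
  have shift: "(\<Sum>k. (K ^^ Suc k) h) = S h - h" for h
    using suminf_split_head[OF summ] by (simp add: S_def)
  have "K (S h) = S h - h" for h
    unfolding shift[symmetric] by (simp add: S_def K.suminf[OF summ])
  then have MS: "M (S h) = h" for h by (simp add: K_def algebra_simps)
  have "S (K h) = S h - h" for h
    unfolding shift[symmetric] by (simp add: S_def funpow_swap1)
  moreover have "S (M h) + S (K h) = S h" for h
    by (simp add: S_add[symmetric] K_def)
  ultimately have SM: "S (M h) = h" for h by (metis add_diff_cancel_left' diff_add_cancel add_diff_eq)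
  have inv: "inv M = S" by (rule inv_equality[OF SM MS])
  show "bounded_clinear (inv M)" using S inv by simp
  show "bij M" by (rule o_bij[of S]) (auto simp: SM MS)
  show "norm (inv M h) \<le> 1 / (1 - q) * norm h" using S_bound inv by simp
  show "1 / (1 + q) * norm h \<le> norm (inv M h)"
  proof -
    have "h = S h - K (S h)" by (simp add: K_def MS)
    then have "norm h \<le> norm (S h) + norm (K (S h))" by (metis norm_triangle_ineq4)
    also have "\<dots> \<le> (1 + q) * norm (S h)" using le[of "S h"] by (simp add: algebra_simps)
    finally show ?thesis using q inv by (simp add: field_simps)
  qed
  have "op_sums (\<lambda>k. K ^^ k) S"
    unfolding op_sums_def
  proof (intro conjI allI pow(1) S)
    show "(\<lambda>N. onorm (\<lambda>h. S h - (\<Sum>k<N. (K ^^ k) h))) \<longlonglongrightarrow> 0"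
    proof (rule tendsto_sandwich)
      show "\<forall>\<^sub>F N in sequentially. 0 \<le> onorm (\<lambda>h. S h - (\<Sum>k<N. (K ^^ k) h))"
        using S by (intro always_eventually allI onorm_pos_le bounded_linear_sub
            bounded_linear_sum powl(1)) (simp add: bounded_clinear_def)
      show "\<forall>\<^sub>F N in sequentially. onorm (\<lambda>h. S h - (\<Sum>k<N. (K ^^ k) h)) \<le> q ^ N / (1 - q)"
        using q by (intro always_eventually allI onorm_bound tail) simp
      show "(\<lambda>N. q ^ N / (1 - q)) \<longlonglongrightarrow> 0"
        using q by (intro tendsto_divide_zero LIMSEQ_realpow_zero)
    qed simp
  qed
  then show "op_sums (\<lambda>k. (\<lambda>h. h - M h) ^^ k) (inv M)" using inv by (simp add: K_def)
qed

text \<open>Stated for an abstract error operator so that it covers both multipliers: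
  \<open>I - M\<close> is the negative of a mixed Bessel operator, a contraction with factor
  \<open>q\<close>.\<close>

lemma multiplier_neumann:
  fixes X Y :: "nat \<Rightarrow> 'a::complex_hilbert"
  assumes series: "\<And>f. (\<lambda>n. (m n * cinner f (\<Psi> n)) *\<^sub>C \<Phi> n) sums (f + (\<Sum>n. cinner f (X n) *\<^sub>C Y n))"
    and X: "bessel X C" and Y: "bessel Y D" and CD: "C * D < 1"
  defines "M \<equiv> multiplier m \<Phi> \<Psi>" and "q \<equiv> sqrt (C * D)"
  shows "multiplier_invertible m \<Phi> \<Psi>"
    and "norm (h - M h) \<le> q * norm h"
    and "1 / (1 + q) * norm h \<le> norm (inv M h)"
    and "norm (inv M h) \<le> 1 / (1 - q) * norm h"
    and "op_sums (\<lambda>k. (\<lambda>h. h - M h) ^^ k) (inv M)"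
proof -
  let ?T = "\<lambda>f. \<Sum>n. cinner f (X n) *\<^sub>C Y n"
  note T = bessel_mixed_operator[OF X Y]
  have M: "M f = f + ?T f" for f
    unfolding M_def multiplier_def using series[of f] by (rule sums_unique[symmetric])
  then have diff: "h - M h = - ?T h" for h by simp
  have q: "0 \<le> q" "q < 1"
    using X Y CD real_sqrt_less_mono[OF CD] by (auto simp: q_def bessel_def)
  have le: "norm (h - M h) \<le> q * norm h" for h
    unfolding diff q_def using T(2) by simp
  then show "norm (h - M h) \<le> q * norm h" .
  have Tl: "bounded_linear ?T" "?T (c *\<^sub>C x) = c *\<^sub>C ?T x" for c x
    using T(3) by (simp_all only: bounded_clinear_def)
  have K: "bounded_clinear (\<lambda>h. h - M h)"
    unfolding diff bounded_clinear_def
    by (simp only: bounded_linear_minus[OF Tl(1)] Tl(2) complex_vector.scale_minus_right simp_thms)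
  note N = neumann_series[OF K le q]
  show "multiplier_invertible m \<Phi> \<Psi>"
    unfolding multiplier_invertible_def M_def[symmetric]
    using N(1,2) series by (auto simp: sums_iff bij_is_inj bij_is_surj surj_f_inv_f intro!: exI[of _ "inv M"])
  show "1 / (1 + q) * norm h \<le> norm (inv M h)" "norm (inv M h) \<le> 1 / (1 - q) * norm h"
    "op_sums (\<lambda>k. (\<lambda>h. h - M h) ^^ k) (inv M)"
    by (fact N(4), fact N(5), fact N(3))
qed

section \<open>Removing semi-normalized weights from a frame\<close>

lemma is_frame_unscale:
  assumes frame: "is_frame (\<lambda>n. m n *\<^sub>C \<Psi> n)" and m: "semi_normalized m"
  shows "is_frame \<Psi>"
proof -
  obtain A B where AB: "has_frame_bounds (\<lambda>n. m n *\<^sub>C \<Psi> n) A B"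
    using frame by (auto simp: is_frame_def)
  obtain a b where ab: "0 < a" "\<And>n. a \<le> cmod (m n)" "\<And>n. cmod (m n) \<le> b"
    using m by (auto simp: semi_normalized_def)
  have b: "0 < b" using ab order.strict_trans2 order_trans by metis
  \<comment> \<open>The weights enter the squared coefficients as factors between \<open>a^2\<close>
    and \<open>b^2\<close>, so dividing them out costs \<open>b^2\<close> in the lower bound and
    \<open>a^2\<close> in the upper one.\<close>
  have "has_frame_bounds \<Psi> (A / b\<^sup>2) (B / a\<^sup>2)"
    unfolding has_frame_bounds_def
  proof (intro conjI allI)
    show "0 < A / b\<^sup>2" using AB b by (simp add: has_frame_bounds_def)
    fix h :: 'a
    let ?s = "\<lambda>n. (cmod (cinner h (\<Psi> n)))\<^sup>2" and ?t = "\<lambda>n. (cmod (cinner h (m n *\<^sub>C \<Psi> n)))\<^sup>2"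
    have t: "?t n = (cmod (m n))\<^sup>2 * ?s n" for n
      by (simp add: cinner_scaleC_right norm_mult power_mult_distrib)
    have sb: "summable ?t" "A * (norm h)\<^sup>2 \<le> suminf ?t" "suminf ?t \<le> B * (norm h)\<^sup>2"
      using AB by (auto simp: has_frame_bounds_def)
    have lo: "a\<^sup>2 * ?s n \<le> ?t n" and hi: "?t n \<le> b\<^sup>2 * ?s n" for n
      unfolding t using ab b by (intro mult_right_mono power_mono; simp add: less_imp_le)+
    \<comment> \<open>Summability passes from the weighted to the unweighted coefficients because
      the weights stay away from zero.\<close>
    have "summable (\<lambda>n. a\<^sup>2 * ?s n)"
      by (rule summable_comparison_test'[OF sb(1), of 0]) (use lo in \<open>simp add: abs_mult\<close>)
    then show s: "summable ?s" using ab(1) by (simp add: summable_cmult_iff)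
    have "suminf ?t \<le> b\<^sup>2 * suminf ?s"
      unfolding suminf_mult[OF s, symmetric] by (intro suminf_le hi sb summable_mult s)
    then show "A / b\<^sup>2 * (norm h)\<^sup>2 \<le> suminf ?s" using sb(2) b by (simp add: field_simps)
    have "a\<^sup>2 * suminf ?s \<le> suminf ?t"
      unfolding suminf_mult[OF s, symmetric] by (intro suminf_le lo sb summable_mult s)
    then show "suminf ?s \<le> B / a\<^sup>2 * (norm h)\<^sup>2" using sb(3) ab(1) by (simp add: field_simps)
  qed
  then show ?thesis by (auto simp: is_frame_def)
qed

section \<open>Invertibility of both multipliers and the frame property\<close>

theorem proposition4p10:
  fixes \<Phi> \<Psi> \<Phi>d :: "nat \<Rightarrow> 'a::complex_hilbert"
    and m :: "nat \<Rightarrow> complex"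
    and A B \<mu> :: real
  assumes separable: "separable_space (euclidean :: 'a topology)"
    and infinite_dim: "infinite_dimensional TYPE('a)"
    and frame: "has_frame_bounds \<Phi> A B"
    and nonzero: "\<And>n. m n \<noteq> 0" "\<And>n. \<Phi> n \<noteq> 0" "\<And>n. \<Psi> n \<noteq> 0"
    and dual: "is_dual_frame \<Phi> \<Phi>d"
    and mu: "0 \<le> \<mu>" "\<mu> < 1 / B"
    and perturbation:
      "\<And>f. summable (\<lambda>n. (cmod (cinner f (m n *\<^sub>C \<Psi> n - \<Phi>d n)))\<^sup>2) \<and>
            (\<Sum>n. (cmod (cinner f (m n *\<^sub>C \<Psi> n - \<Phi>d n)))\<^sup>2) \<le> \<mu> * (norm f)\<^sup>2"
  shows "is_frame (\<lambda>n. m n *\<^sub>C \<Psi> n) \<and>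
         multiplier_invertible (\<lambda>n. cnj (m n)) \<Phi> \<Psi> \<and>
         multiplier_invertible m \<Psi> \<Phi> \<and>
         (\<forall>M \<in> {multiplier (\<lambda>n. cnj (m n)) \<Phi> \<Psi>, multiplier m \<Psi> \<Phi>}.
            (\<forall>h. 1 / (1 + sqrt (\<mu> * B)) * norm h \<le> norm (inv M h) \<and>
                 norm (inv M h) \<le> 1 / (1 - sqrt (\<mu> * B)) * norm h) \<and>
            op_sums (\<lambda>k. (\<lambda>h. h - M h) ^^ k) (inv M)) \<and>
         (semi_normalized m \<longrightarrow> is_frame \<Psi>)"
proof -
  \<comment> \<open>Since \<open>1 / 0 = 0\<close> in HOL, this excludes \<open>B = 0\<close> as
    well as negative \<open>B\<close>.\<close>
  have "0 < 1 / B" using mu by linarith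
  then have B: "0 < B" by simp
  then have muB: "\<mu> * B < 1" using mu by (simp add: field_simps)
  define g where "g n = m n *\<^sub>C \<Psi> n" for n
  define e where "e n = g n - \<Phi>d n" for n
  have \<Phi>: "bessel \<Phi> B" using frame_imp_bessel[OF frame] B by simp
  have e: "bessel e \<mu>" using mu(1) perturbation by (simp add: bessel_def e_def g_def)
  obtain D where d: "bessel \<Phi>d D"
    using dual by (auto simp: is_dual_frame_def is_frame_def dest: frame_imp_bessel)
  have dual_sums: "(\<lambda>n. cinner f (\<Phi>d n) *\<^sub>C \<Phi> n) sums f" "(\<lambda>n. cinner f (\<Phi> n) *\<^sub>C \<Phi>d n) sums f" for f
    using dual by (simp_all add: is_dual_frame_def)
  \<comment> \<open>Here \<open>m n\<close> sits in the second argument of \<open>cinner\<close>,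
    which is conjugate-linear; this is the source of \<open>cnj (m n)\<close>. Splitting
    \<open>g n = \<Phi>d n + e n\<close> leaves the identity plus an error.\<close>
  have series1: "(\<lambda>n. (cnj (m n) * cinner f (\<Psi> n)) *\<^sub>C \<Phi> n) sums (f + (\<Sum>n. cinner f (e n) *\<^sub>C \<Phi> n))"
    for f
    using sums_add[OF dual_sums(1) summable_sums[OF bessel_mixed_operator(1)[OF e \<Phi>]], of f f]
    by (simp add: scaleC_add_left[symmetric] cinner_add_right[symmetric] e_def g_def
        cinner_scaleC_right)
  \<comment> \<open>Now \<open>m n\<close> scales the synthesis vector, so no conjugate appears; the
    second reconstruction formula supplies the identity.\<close>
  have series2: "(\<lambda>n. (m n * cinner f (\<Phi> n)) *\<^sub>C \<Psi> n) sums (f + (\<Sum>n. cinner f (\<Phi> n) *\<^sub>C e n))"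
    for f
    using sums_add[OF dual_sums(2) summable_sums[OF bessel_mixed_operator(1)[OF \<Phi> e]], of f f]
    by (simp add: scaleC_add_right[symmetric] e_def g_def scaleC_scaleC mult.commute)
  note M1 = multiplier_neumann[OF series1 e \<Phi> muB]
  have Bmu: "B * \<mu> < 1" using muB by (simp add: mult.commute)
  \<comment> \<open>The exchanged roles produce \<open>B * \<mu>\<close>; commuting the product
    gives both multipliers the same constant.\<close>
  note M2 = multiplier_neumann[OF series2 \<Phi> e Bmu, unfolded mult.commute[of B \<mu>]]
  let ?M1 = "multiplier (\<lambda>n. cnj (m n)) \<Phi> \<Psi>"
  let ?q = "sqrt (\<mu> * B)"
  have q: "?q < 1" using muB by simp
  have g: "bessel g (2 * D + 2 * \<mu>)" using bessel_add[OF d e] by (simp add: e_def)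
  \<comment> \<open>The lower bound squares
    \<open>(1 - ?q) * norm h \<le> norm (?M1 h) \<le> sqrt B * sqrt ?s\<close>, where
    \<open>?M1 h\<close> is synthesized by \<open>\<Phi>\<close> from the coefficients of
    \<open>h\<close> against \<open>g\<close>. The upper bound is that of \<open>\<Phi>d\<close>
    plus \<open>e\<close>.\<close>
  have "has_frame_bounds g ((1 - ?q)\<^sup>2 / B) (2 * D + 2 * \<mu>)"
    unfolding has_frame_bounds_def
  proof (intro conjI allI)
    show "0 < (1 - ?q)\<^sup>2 / B" using q B by simp
    fix h :: 'a
    let ?s = "\<Sum>n. (cmod (cinner h (g n)))\<^sup>2"
    show summ: "summable (\<lambda>n. (cmod (cinner h (g n)))\<^sup>2)" and "?s \<le> (2 * D + 2 * \<mu>) * (norm h)\<^sup>2"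
      using g by (auto simp: bessel_def)
    have "?M1 h = (\<Sum>n. cinner h (g n) *\<^sub>C \<Phi> n)"
      by (simp add: multiplier_def g_def cinner_scaleC_right)
    then have "norm (?M1 h) \<le> sqrt B * sqrt ?s"
      using bessel_synthesis(2)[OF \<Phi> summ] by simp
    moreover have "norm h \<le> norm (h - ?M1 h) + norm (?M1 h)"
      using norm_triangle_ineq[of "h - ?M1 h" "?M1 h"] by simp
    ultimately have "(1 - ?q) * norm h \<le> sqrt B * sqrt ?s"
      using M1(2)[of h] by (simp add: algebra_simps)
    \<comment> \<open>Squaring preserves the inequality because \<open>?q < 1\<close> makes the left
      side nonnegative.\<close>
    then have "((1 - ?q) * norm h)\<^sup>2 \<le> (sqrt B * sqrt ?s)\<^sup>2"
      using q by (intro power_mono) auto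
    then have "(1 - ?q)\<^sup>2 * (norm h)\<^sup>2 \<le> B * ?s"
      using B by (simp add: power_mult_distrib suminf_nonneg[OF summ])
    then show "(1 - ?q)\<^sup>2 / B * (norm h)\<^sup>2 \<le> ?s" using B by (simp add: field_simps)
  qed
  then have "is_frame (\<lambda>n. m n *\<^sub>C \<Psi> n)" unfolding is_frame_def g_def by blast
  then show ?thesis
    using M1(1,3,4,5) M2(1,3,4,5) is_frame_unscale by blast
qed

end
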